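(* Let $(X,d)$ be a metric space with more than one element, let $M>0$, and let $d_E,d_{Em}:E\times E\to[0,\infty)$ be the associated functions on the set $E$ of finite multisets of $X$. If $d$ is unbounded, then for every $M>0$ neither $d_E$ nor $d_{Em}$ is a metric on $E$. If $d$ is bounded and $\theta=\frac{\sup d}{M}$, then $d_E$ is a metric on $E$ if and only if $\theta\le 2$, and $d_{Em}$ is a metric on $E$ if and only if $\theta\le 1$.
   Context: A (finite) multiset of $X$ is a function $e:X\to\mathbb{N}$ (with $0\in\mathbb{N}$) of finite support; $E$ is the set of all of them. The cardinality of $e$ is $C(e)=\sum_{x\in X}e(x)$. The multiset $e_0$ is the empty multiset (the zero function). Fix $M>0$. For $a,c\in E$ with $C(a)\le C(c)$, list the elements with multiplicity in arbitrary order as $a_1,\dots,a_{C(a)}$ and $c_1,\dots,c_{C(c)}$ (so $\#\{j:a_j=x\}=a(x)$ and $\#\{j:c_j=x\}=c(x)$ for all $x\in X$). Let $G_c$ be the group of permutations of $\{1,\dots,C(c)\}$. Define $$d_E(a,c)=d_E(c,a)=\min_{\gamma\in G_c}\Big(\sum_{j=1}^{C(a)}d(a_j,c_{\gamma(j)})+M\,|C(c)-C(a)|\Big),$$ $$d_{Em}(a,c)=\frac{d_E(a,c)}{\max(C(a),C(c))},$$ with $d_E(e_0,e_0)=d_{Em}(e_0,e_0)=0$. When $d$ is bounded, $\sup d$ denotes $\sup_{x,y\in X}d(x,y)$. *)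

theory Defs
  imports
    "HOL-Analysis.Abstract_Metric_Spaces"
    "HOL-Library.Multiset"
    "HOL-Combinatorics.Permutations"
begin

definition finite_multisets :: "'a set \<Rightarrow> 'a multiset set" where
  "finite_multisets X = {a. set_mset a \<subseteq> X}"

text \<open>
  The cost of the permutation \<open>\<gamma>\<close> for the lists \<open>xs\<close> and \<open>ys\<close>, meant for
  \<open>length xs \<le> length ys\<close>. Positions are counted from \<open>0\<close>, so \<open>\<gamma>\<close> ranges over the
  permutations of \<open>{..<length ys}\<close>.
\<close>

definition match_cost ::
  "('a \<Rightarrow> 'a \<Rightarrow> real) \<Rightarrow> real \<Rightarrow> 'a list \<Rightarrow> 'a list \<Rightarrow> (nat \<Rightarrow> nat) \<Rightarrow> real" where
  "match_cost d M xs ys \<gamma> =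
     (\<Sum>j<length xs. d (xs ! j) (ys ! \<gamma> j)) + M * \<bar>real (length ys) - real (length xs)\<bar>"

definition list_dist ::
  "('a \<Rightarrow> 'a \<Rightarrow> real) \<Rightarrow> real \<Rightarrow> 'a list \<Rightarrow> 'a list \<Rightarrow> real" where
  "list_dist d M xs ys = Min (match_cost d M xs ys ` {\<gamma>. \<gamma> permutes {..<length ys}})"

text \<open>An arbitrary listing of the elements with multiplicity; see \<open>d_E_eq_list_dist\<close>.\<close>

definition listing :: "'a multiset \<Rightarrow> 'a list" where
  "listing a = (SOME xs. mset xs = a)"

definition d_E ::
  "('a \<Rightarrow> 'a \<Rightarrow> real) \<Rightarrow> real \<Rightarrow> 'a multiset \<Rightarrow> 'a multiset \<Rightarrow> real" where
  "d_E d M a c =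
     (if size a \<le> size c then list_dist d M (listing a) (listing c)
      else list_dist d M (listing c) (listing a))"

definition d_Em ::
  "('a \<Rightarrow> 'a \<Rightarrow> real) \<Rightarrow> real \<Rightarrow> 'a multiset \<Rightarrow> 'a multiset \<Rightarrow> real" where
  "d_Em d M a c =
     (if a = {#} \<and> c = {#} then 0 else d_E d M a c / real (max (size a) (size c)))"

lemma mset_listing [simp]: "mset (listing a) = a"
  unfolding listing_def by (rule someI_ex) (rule ex_mset)

lemma length_listing [simp]: "length (listing a) = size a"
  by (metis mset_listing size_mset)

lemma list_dist_cong:
  assumes "mset xs = mset xs'" "mset ys = mset ys'" "length xs \<le> length ys"
  shows "list_dist d M xs ys = list_dist d M xs' ys'"
proof -
  have sub: "match_cost d M us' vs' ` {\<gamma>. \<gamma> permutes {..<length vs'}}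
          \<subseteq> match_cost d M us vs ` {\<gamma>. \<gamma> permutes {..<length vs}}"
    if us: "mset us' = mset us" and vs: "mset vs' = mset vs" and le: "length us \<le> length vs"
    for us us' vs vs' :: "'a list"
  proof clarify
    obtain p where p: "p permutes {..<length us}" "permute_list p us = us'"
      using us by (rule mset_eq_permutation)
    obtain q where q: "q permutes {..<length vs}" "permute_list q vs = vs'"
      using vs by (rule mset_eq_permutation)
    have len: "length us' = length us" "length vs' = length vs"
      using p q by auto
    fix \<gamma> assume "\<gamma> permutes {..<length vs'}"
    then have \<gamma>: "\<gamma> permutes {..<length vs}"
      by (simp add: len)
    have p': "p permutes {..<length vs}"
      using p(1) le by (auto intro: permutes_subset)
    let ?g = "q \<circ> \<gamma> \<circ> inv p"
    have g: "?g permutes {..<length vs}"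
      by (intro permutes_compose permutes_inv p' q(1) \<gamma>)
    have "(\<Sum>j<length us. d (us ! j) (vs ! ?g j))
        = (\<Sum>j<length us. d (us ! p j) (vs ! ?g (p j)))"
      using sum.permute [OF p(1), of "\<lambda>j. d (us ! j) (vs ! ?g j)"] by (simp add: o_def)
    also have "\<dots> = (\<Sum>j<length us. d (us' ! j) (vs' ! \<gamma> j))"
    proof (rule sum.cong)
      fix j assume "j \<in> {..<length us}"
      then have j: "j < length us" "\<gamma> j < length vs"
        using le permutes_in_image [OF \<gamma>, of j] by auto
      have "us' ! j = us ! p j" "vs' ! \<gamma> j = vs ! q (\<gamma> j)"
        using permute_list_nth [OF p(1) j(1)] permute_list_nth [OF q(1) j(2)] p(2) q(2) by auto
      then show "d (us ! p j) (vs ! ?g (p j)) = d (us' ! j) (vs' ! \<gamma> j)"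
        by (simp add: permutes_inverses [OF p(1)])
    qed simp
    finally have "match_cost d M us' vs' \<gamma> = match_cost d M us vs ?g"
      by (simp add: match_cost_def len)
    with g show "match_cost d M us' vs' \<gamma> \<in> match_cost d M us vs ` {\<gamma>. \<gamma> permutes {..<length vs}}"
      by blast
  qed
  have "length xs' \<le> length ys'"
    using assms by (metis size_mset)
  then have "match_cost d M xs ys ` {\<gamma>. \<gamma> permutes {..<length ys}}
           = match_cost d M xs' ys' ` {\<gamma>. \<gamma> permutes {..<length ys'}}"
    using sub assms by (intro equalityI) simp_all
  then show ?thesis
    by (simp add: list_dist_def)
qed

lemma d_E_eq_list_dist:
  assumes "mset xs = a" "mset ys = c" "size a \<le> size c"
  shows "d_E d M a c = list_dist d M xs ys"
  unfolding d_E_def using assms list_dist_cong [of "listing a" xs "listing c" ys] by simp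

lemma list_dist_commute:
  assumes "\<And>x y. d x y = d y x" "length xs = length ys"
  shows "list_dist d M xs ys = list_dist d M ys xs"
proof -
  have sub: "match_cost d M us vs ` {\<gamma>. \<gamma> permutes {..<length vs}}
          \<subseteq> match_cost d M vs us ` {\<gamma>. \<gamma> permutes {..<length us}}"
    if len: "length us = length vs" for us vs :: "'a list"
  proof clarify
    fix \<gamma> assume \<gamma>: "\<gamma> permutes {..<length vs}"
    have "(\<Sum>j<length vs. d (vs ! j) (us ! inv \<gamma> j))
        = (\<Sum>j<length vs. d (us ! j) (vs ! \<gamma> j))"
      using sum.permute [OF \<gamma>, of "\<lambda>j. d (vs ! j) (us ! inv \<gamma> j)"] assms(1)
      by (simp add: o_def permutes_inverses [OF \<gamma>])
    then have "match_cost d M us vs \<gamma> = match_cost d M vs us (inv \<gamma>)"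
      by (simp add: match_cost_def len)
    moreover have "inv \<gamma> permutes {..<length us}"
      using permutes_inv [OF \<gamma>] by (simp add: len)
    ultimately show "match_cost d M us vs \<gamma>
        \<in> match_cost d M vs us ` {\<gamma>. \<gamma> permutes {..<length us}}"
      by blast
  qed
  have "match_cost d M xs ys ` {\<gamma>. \<gamma> permutes {..<length ys}}
      = match_cost d M ys xs ` {\<gamma>. \<gamma> permutes {..<length xs}}"
    using sub [of xs ys] sub [of ys xs] assms(2) by (intro equalityI) simp_all
  then show ?thesis
    by (simp add: list_dist_def)
qed

lemma d_E_commute:
  assumes "\<And>x y. d x y = d y x"
  shows "d_E d M a c = d_E d M c a"
  unfolding d_E_def using list_dist_commute [of d "listing a" "listing c" M] assms by auto

lemma d_E_empty: "d_E d M {#} {#} = 0"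
  by (simp add: d_E_eq_list_dist [of "[]" _ "[]"] list_dist_def match_cost_def)

end

theory Submission
  imports Defs
begin

text \<open>
  A partial matching of \<open>a\<close> and \<open>c\<close> is a multiset \<open>R\<close> of pairs whose marginals are contained in
  \<open>a\<close> and \<open>c\<close>; \<open>d_E\<close> is the least cost of one that exhausts the smaller side. Partial matchings
  compose: \<open>R\<close> from \<open>a\<close> to \<open>b\<close> and \<open>S\<close> from \<open>b\<close> to \<open>c\<close> yield some \<open>T\<close> from \<open>a\<close> to \<open>c\<close> of no larger
  total distance with \<open>|R| + |S| \<le> |T| + |b|\<close>. If \<open>d \<le> K\<close>, then \<open>T\<close> can be completed at cost at
  most \<open>K\<close> per added pair. Taking \<open>K = 2 M\<close> gives the triangle inequality for \<open>d_E\<close>, and \<open>K = M\<close>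
  gives \<open>d_E a c + M (|b| - N) \<le> d_E a b + d_E b c\<close> for \<open>N = max |a| |c| \<le> |b|\<close>, which together
  with \<open>d_E a c \<le> M N\<close> yields the one for \<open>d_Em\<close>. Conversely, the bounds on \<open>d x y\<close> are the triangle
  inequalities for \<open>{#x#}\<close>, \<open>{#y#}\<close> through \<open>{#}\<close> and through \<open>{#x, y#}\<close>.
\<close>

section \<open>Partial matchings and their cost\<close>

definition partial_matching :: "'a multiset \<Rightarrow> 'a multiset \<Rightarrow> ('a \<times> 'a) multiset \<Rightarrow> bool" where
  "partial_matching a c R \<longleftrightarrow> image_mset fst R \<subseteq># a \<and> image_mset snd R \<subseteq># c"

definition pair_cost :: "('a \<Rightarrow> 'a \<Rightarrow> real) \<Rightarrow> ('a \<times> 'a) multiset \<Rightarrow> real" where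
  "pair_cost d R = (\<Sum>(x, y)\<in>#R. d x y)"

lemma pair_cost_empty [simp]: "pair_cost d {#} = 0"
  by (simp add: pair_cost_def)

lemma pair_cost_add_mset [simp]: "pair_cost d (add_mset (x, y) R) = d x y + pair_cost d R"
  by (simp add: pair_cost_def)

lemma pair_cost_union [simp]: "pair_cost d (R + S) = pair_cost d R + pair_cost d S"
  by (simp add: pair_cost_def)

lemma pair_cost_nonneg:
  assumes "\<And>x y. 0 \<le> d x y"
  shows "0 \<le> pair_cost d R"
  by (induction R) (auto simp: assms)

lemma pair_cost_le:
  assumes "\<And>x y. (x, y) \<in># R \<Longrightarrow> d x y \<le> K"
  shows "pair_cost d R \<le> K * real (size R)"
  using assms
proof (induction R)
  case (add p R)
  obtain x y where p: "p = (x, y)" by force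
  have "pair_cost d R \<le> K * real (size R)" "d x y \<le> K"
    using add p by auto
  then show ?case by (simp add: p algebra_simps)
qed simp

lemma pair_cost_eq_0D:
  assumes "\<And>x y. 0 \<le> d x y" "pair_cost d R = 0" "(x, y) \<in># R"
  shows "d x y = 0"
proof -
  obtain S where "R = add_mset (x, y) S"
    using assms(3) by (blast dest: multi_member_split)
  with assms(2) pair_cost_nonneg [of d S, OF assms(1)] assms(1) [of x y] show ?thesis
    by simp
qed

lemma pair_cost_swap:
  assumes "\<And>x y. d x y = d y x"
  shows "pair_cost d (image_mset prod.swap R) = pair_cost d R"
  by (induction R) (auto simp: assms)

lemma partial_matching_swap:
  "partial_matching a c R \<Longrightarrow> partial_matching c a (image_mset prod.swap R)"
  by (simp add: partial_matching_def image_mset.compositionality comp_def)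

lemma size_partial_matching:
  assumes "partial_matching a c R"
  shows "size R \<le> size a" "size R \<le> size c"
  using assms size_mset_mono unfolding partial_matching_def by fastforce+

text \<open>For two empty multisets the quotient is a division by \<open>0\<close>, which HOL
  evaluates to \<open>0\<close>, so the case distinction disappears.\<close>

lemma d_Em_eq: "d_Em d M a c = d_E d M a c / real (max (size a) (size c))"
  by (simp add: d_Em_def)

section \<open>Permutations as full matchings\<close>

lemma finite_match_costs: "finite (match_cost d M xs ys ` {\<gamma>. \<gamma> permutes {..<length ys}})"
  by (simp add: finite_permutations)

lemma d_E_attained:
  assumes "size a \<le> size c"
  obtains R where "partial_matching a c R" "size R = size a"
    "d_E d M a c = pair_cost d R + M * (real (size c) - real (size a))"
proof -
  let ?xs = "listing a" and ?ys = "listing c"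
  let ?P = "{\<gamma>. \<gamma> permutes {..<length ?ys}}"
  have "id \<in> ?P" by (simp add: permutes_id)
  then have "match_cost d M ?xs ?ys ` ?P \<noteq> {}" by blast
  then have "list_dist d M ?xs ?ys \<in> match_cost d M ?xs ?ys ` ?P"
    unfolding list_dist_def using finite_match_costs by (rule Min_in [rotated])
  then obtain \<gamma> where \<gamma>: "\<gamma> permutes {..<length ?ys}"
    and eq: "list_dist d M ?xs ?ys = match_cost d M ?xs ?ys \<gamma>" by blast
  let ?R = "image_mset (\<lambda>j. (?xs ! j, ?ys ! \<gamma> j)) (mset_set {..<size a})"
  have fst: "image_mset fst ?R = a"
  proof -
    have "image_mset fst ?R = mset (map ((!) ?xs) [0..<length ?xs])"
      by (simp add: image_mset.compositionality comp_def atLeast0LessThan)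
    then show ?thesis by (simp only: map_nth mset_listing)
  qed
  \<comment> \<open>Enlarging the index range from \<open>size a\<close> to \<open>size c\<close>
    turns the second coordinates into the whole permuted listing of \<open>c\<close>.\<close>
  have "image_mset (\<lambda>j. ?ys ! \<gamma> j) (mset_set {..<size a})
      \<subseteq># image_mset (\<lambda>j. ?ys ! \<gamma> j) (mset_set {..<size c})"
    using assms by (intro image_mset_subseteq_mono subset_imp_msubset_mset_set) auto
  also have "\<dots> = mset (permute_list \<gamma> ?ys)"
    by (simp add: permute_list_def atLeast0LessThan)
  also have "\<dots> = c"
    using mset_permute_list [OF \<gamma>] by simp
  finally have "image_mset snd ?R \<subseteq># c"
    by (simp add: image_mset.compositionality comp_def)
  with fst have "partial_matching a c ?R"
    by (simp add: partial_matching_def)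
  moreover have "d_E d M a c = pair_cost d ?R + M * (real (size c) - real (size a))"
    using assms eq
    by (simp add: d_E_def match_cost_def pair_cost_def image_mset.compositionality comp_def
        sum_unfold_sum_mset)
  ultimately show ?thesis
    using that by simp
qed

text \<open>List the matched pairs first and append the unmatched elements \<open>zs\<close> of
  \<open>c\<close>. As \<open>d_E\<close> does not depend on the listing, the identity permutation
  realises \<open>R\<close>, and the minimum is at most its cost.\<close>

lemma d_E_le_full_matching:
  assumes "partial_matching a c R" "size R = size a"
  shows "d_E d M a c \<le> pair_cost d R + M * (real (size c) - real (size a))"
proof -
  obtain ps where ps: "mset ps = R" using ex_mset by blast
  have "image_mset fst R \<subseteq># a" "image_mset snd R \<subseteq># c"
    using assms(1) by (auto simp: partial_matching_def)
  moreover from this have "image_mset fst R = a"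
    using assms(2) by (metis mset_subset_size size_image_mset subset_mset.le_imp_less_or_eq nat_less_le)
  ultimately obtain zs where c: "c = image_mset snd R + mset zs" and a: "a = image_mset fst R"
    by (metis ex_mset subset_mset.add_diff_inverse)
  let ?xs = "map fst ps" and ?ys = "map snd ps @ zs"
  have "d_E d M a c = list_dist d M ?xs ?ys"
    by (rule d_E_eq_list_dist) (simp_all add: a c ps)
  also have "\<dots> \<le> match_cost d M ?xs ?ys id"
    unfolding list_dist_def
    by (intro Min_le finite_match_costs imageI CollectI permutes_id)
  also have "\<dots> = (\<Sum>j<length ps. d (fst (ps ! j)) (snd (ps ! j)))
      + M * (real (size c) - real (size a))"
    using ps by (simp add: match_cost_def a c nth_append flip: size_mset)
  also have "(\<Sum>j<length ps. d (fst (ps ! j)) (snd (ps ! j))) = pair_cost d R"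
    unfolding pair_cost_def ps [symmetric] case_prod_beta mset_map [symmetric] sum_mset_sum_list
    by (simp add: sum_list_sum_nth atLeast0LessThan)
  finally show ?thesis by simp
qed

lemma ex_pairing:
  assumes "size a \<le> size c"
  obtains R where "partial_matching a c R" "size R = size a"
  \<comment> \<open>Only the existence of the matching is wanted, so the cost data are
    arbitrary.\<close>
  using d_E_attained [OF assms, of _ 0] by metis

section \<open>Composition of partial matchings\<close>

text \<open>Induction on \<open>R\<close> removes a pair \<open>(x, y)\<close>. If \<open>S\<close>
  contains some \<open>(y, z)\<close>, the two are glued to \<open>(x, z)\<close>, at no larger cost
  by the triangle inequality; otherwise \<open>(x, y)\<close> is dropped.\<close>

lemma partial_matching_compose:
  assumes "Metric_space X d" "set_mset a \<subseteq> X" "set_mset b \<subseteq> X" "set_mset c \<subseteq> X"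
    and "partial_matching a b R" "partial_matching b c S"
  shows "\<exists>T. partial_matching a c T \<and> pair_cost d T \<le> pair_cost d R + pair_cost d S \<and>
    size R + size S \<le> size T + size b"
  using assms(2-)
proof (induction R arbitrary: a b c S)
  case empty
  interpret Metric_space X d by fact
  have "size S \<le> size b" "0 \<le> pair_cost d S"
    using size_partial_matching [OF empty.prems(5)] pair_cost_nonneg [of d S, OF nonneg] by auto
  then show ?case
    by (intro exI [of _ "{#}"]) (simp add: partial_matching_def)
next
  case (add p R)
  interpret Metric_space X d by fact
  obtain x y where p: "p = (x, y)" by force
  have "x \<in># a" "y \<in># b"
    using add.prems(4) by (auto simp: partial_matching_def p dest: mset_subset_eqD)
  then obtain a' b' where a: "a = add_mset x a'" and b: "b = add_mset y b'"
    by (blast dest: multi_member_split)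
  have R: "partial_matching a' b' R"
    using add.prems(4) by (simp add: partial_matching_def p a b)
  show ?case
  proof (cases "y \<in># image_mset fst S")
    case True
    then obtain z S' where S: "S = add_mset (y, z) S'"
      by (auto dest: multi_member_split)
    have "z \<in># c"
      using add.prems(5) by (auto simp: partial_matching_def S dest: mset_subset_eqD)
    then obtain c' where c: "c = add_mset z c'"
      by (blast dest: multi_member_split)
    have S': "partial_matching b' c' S'"
      using add.prems(5) by (simp add: partial_matching_def b c S)
    obtain T where T: "partial_matching a' c' T"
      "pair_cost d T \<le> pair_cost d R + pair_cost d S'" "size R + size S' \<le> size T + size b'"
      using add.IH [OF _ _ _ R S'] add.prems(1-3) a b c by auto
    have "d x z \<le> d x y + d y z"
      using add.prems(1-3) a b c by (intro triangle) auto
    with T show ?thesis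
      by (intro exI [of _ "add_mset (x, z) T"]) (simp add: partial_matching_def p a b c S)
  next
    case False
    \<comment> \<open>\<open>S\<close> matches no copy of \<open>y\<close>, so it survives the
      removal of one copy from \<open>b\<close>. The count stays balanced: \<open>R\<close> loses
      one pair, \<open>b\<close> one element.\<close>
    then have "image_mset fst S \<subseteq># b'"
      using add.prems(5) unfolding partial_matching_def b
      by (metis diff_single_trivial subset_eq_diff_conv add_mset_add_single)
    then have S: "partial_matching b' c S"
      using add.prems(5) by (simp add: partial_matching_def)
    obtain T where T: "partial_matching a' c T"
      "pair_cost d T \<le> pair_cost d R + pair_cost d S" "size R + size S \<le> size T + size b'"
      using add.IH [OF _ _ _ R S] add.prems(1-3) a b by auto
    then have "partial_matching a c T"
      unfolding partial_matching_def a by (metis mset_subset_eq_add_right add_mset_add_single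
          subset_mset.order_trans union_commute)
    moreover have "pair_cost d T \<le> d x y + pair_cost d R + pair_cost d S"
      using T(2) nonneg [of x y] by linarith
    ultimately show ?thesis
      using T(3)
      by (intro exI [of _ T]) (simp add: p b)
  qed
qed

section \<open>Distances through matchings in a metric space\<close>

context Metric_space
begin

lemma d_E_attained_min:
  obtains R where "partial_matching a c R" "size R = min (size a) (size c)"
    "d_E d K a c = pair_cost d R + K * \<bar>real (size a) - real (size c)\<bar>"
proof (cases "size a \<le> size c")
  case True
  with that show ?thesis by (auto intro: d_E_attained [of a c d K])
next
  case False
  then obtain R where R: "partial_matching c a R" "size R = size c"
    "d_E d K c a = pair_cost d R + K * (real (size a) - real (size c))"
    using d_E_attained [of c a] by auto
  then show ?thesis
    using False commute partial_matching_swap [OF R(1)]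
    by (intro that [of "image_mset prod.swap R"])
      (auto simp: pair_cost_swap d_E_commute [of d K a c])
qed

lemma d_E_le_partial_matching:
  assumes le: "\<And>x y. \<lbrakk>x \<in> M; y \<in> M\<rbrakk> \<Longrightarrow> d x y \<le> B"
    and "set_mset a \<subseteq> M" "set_mset c \<subseteq> M" "partial_matching a c R"
  shows "d_E d K a c \<le> pair_cost d R + B * (real (min (size a) (size c)) - real (size R))
    + K * \<bar>real (size a) - real (size c)\<bar>"
proof -
  have *: "d_E d K a c \<le> pair_cost d R + B * (real (size a) - real (size R))
      + K * (real (size c) - real (size a))"
    if sub: "set_mset a \<subseteq> M" "set_mset c \<subseteq> M" and R: "partial_matching a c R"
      and size: "size a \<le> size c" for a c R
  proof -
    \<comment> \<open>\<open>R\<close> takes equally many elements from both sides, so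
      \<open>size a' \<le> size c'\<close> for the remainders, and \<open>a'\<close> can be matched
      completely at cost at most \<open>B\<close> per pair.\<close>
    obtain a' c' where a: "a = image_mset fst R + a'" and c: "c = image_mset snd R + c'"
      using R by (metis partial_matching_def subset_mset.add_diff_inverse)
    then obtain S where S: "partial_matching a' c' S" "size S = size a'"
      using size ex_pairing [of a' c'] by auto
    have "partial_matching a c (R + S)" "size (R + S) = size a"
      using S by (auto simp: partial_matching_def a c)
    then have "d_E d K a c \<le> pair_cost d (R + S) + K * (real (size c) - real (size a))"
      by (rule d_E_le_full_matching)
    moreover have "pair_cost d S \<le> B * real (size S)"
    proof (intro pair_cost_le le)
      fix x y assume "(x, y) \<in># S"
      then have "x \<in># image_mset fst S" "y \<in># image_mset snd S" by force+
      then have "x \<in># a'" "y \<in># c'"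
        using S(1) by (auto simp only: partial_matching_def dest: mset_subset_eqD)
      then show "x \<in> M" "y \<in> M"
        using sub a c by auto
    qed
    ultimately show ?thesis
      using S(2) by (simp add: a)
  qed
  show ?thesis
  proof (cases "size a \<le> size c")
    case True
    with * [OF assms(2-4)] show ?thesis by simp
  next
    case False
    with * [OF assms(3,2) partial_matching_swap [OF assms(4)]] show ?thesis
      using commute by (simp add: pair_cost_swap d_E_commute [of d K a c])
  qed
qed

section \<open>Nonnegativity and zero distance\<close>

lemma d_E_nonneg: "0 \<le> K \<Longrightarrow> 0 \<le> d_E d K a c"
  using d_E_attained_min [of a c K] pair_cost_nonneg [of d, OF nonneg]
  by (metis abs_ge_zero add_nonneg_nonneg mult_nonneg_nonneg)

lemma d_E_eq_0_iff:
  assumes "0 < K" "set_mset a \<subseteq> M" "set_mset c \<subseteq> M"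
  shows "d_E d K a c = 0 \<longleftrightarrow> a = c"
proof
  assume eq: "d_E d K a c = 0"
  obtain R where R: "partial_matching a c R" "size R = min (size a) (size c)"
    and "d_E d K a c = pair_cost d R + K * \<bar>real (size a) - real (size c)\<bar>"
    by (rule d_E_attained_min)
  with eq pair_cost_nonneg [of d R, OF nonneg] \<open>0 < K\<close>
  have cost: "pair_cost d R = 0" and size: "size a = size c"
    by (auto simp: add_nonneg_eq_0_iff)
  \<comment> \<open>With equal sizes \<open>R\<close> exhausts both sides; its cost being zero, all
    its pairs lie on the diagonal.\<close>
  have "image_mset fst R = a" "image_mset snd R = c"
    using R size unfolding partial_matching_def
    by (metis min.idem mset_subset_size size_image_mset subset_mset.le_imp_less_or_eq nat_less_le)+
  moreover have "fst p = snd p" if "p \<in># R" for p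
  proof -
    have "fst p \<in># a" "snd p \<in># c"
      using that calculation by auto
    moreover have "d (fst p) (snd p) = 0"
      using pair_cost_eq_0D [OF nonneg cost] that by simp
    ultimately show ?thesis
      using assms(2,3) zero by (metis subsetD)
  qed
  ultimately show "a = c"
    by (metis image_mset_cong)
next
  assume "a = c"
  let ?R = "image_mset (\<lambda>x. (x, x)) a"
  have "partial_matching a a ?R"
    by (simp add: partial_matching_def image_mset.compositionality comp_def)
  then have "d_E d K a a \<le> pair_cost d ?R"
    using d_E_le_full_matching [of a a ?R d K] by simp
  moreover have "pair_cost d (image_mset (\<lambda>x. (x, x)) b) = 0" if "set_mset b \<subseteq> M" for b
    using that by (induction b) auto
  ultimately show "d_E d K a c = 0"
    using assms \<open>a = c\<close> d_E_nonneg [of K a c] by force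
qed

section \<open>Triangle inequalities for \<open>d_E\<close>\<close>

text \<open>Common source of the next two inequalities: \<open>k\<close> is the size of the composed
  matching, and \<open>B\<close> is kept apart from \<open>K\<close> so that it can become
  \<open>2 * K\<close> or \<open>K\<close>.\<close>

lemma d_E_triangle_bound:
  assumes le: "\<And>x y. \<lbrakk>x \<in> M; y \<in> M\<rbrakk> \<Longrightarrow> d x y \<le> B"
    and "set_mset a \<subseteq> M" "set_mset b \<subseteq> M" "set_mset c \<subseteq> M"
  obtains k where "k \<le> min (size a) (size c)"
    "min (size a) (size b) + min (size b) (size c) \<le> k + size b"
    "d_E d K a c \<le> d_E d K a b + d_E d K b c
      + B * (real (min (size a) (size c)) - real k)
      + K * (\<bar>real (size a) - real (size c)\<bar>
        - \<bar>real (size a) - real (size b)\<bar> - \<bar>real (size b) - real (size c)\<bar>)"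
proof -
  obtain R where R: "partial_matching a b R" "size R = min (size a) (size b)"
    "d_E d K a b = pair_cost d R + K * \<bar>real (size a) - real (size b)\<bar>"
    by (rule d_E_attained_min)
  obtain S where S: "partial_matching b c S" "size S = min (size b) (size c)"
    "d_E d K b c = pair_cost d S + K * \<bar>real (size b) - real (size c)\<bar>"
    by (rule d_E_attained_min)
  obtain T where T: "partial_matching a c T"
    "pair_cost d T \<le> pair_cost d R + pair_cost d S" "size R + size S \<le> size T + size b"
    using partial_matching_compose [OF Metric_space_axioms assms(2-4) R(1) S(1)] by blast
  show ?thesis
  proof (rule that [of "size T"])
    show "size T \<le> min (size a) (size c)"
      using size_partial_matching [OF T(1)] by simp
    show "min (size a) (size b) + min (size b) (size c) \<le> size T + size b"
      using T(3) R(2) S(2) by simp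
    show "d_E d K a c \<le> d_E d K a b + d_E d K b c
      + B * (real (min (size a) (size c)) - real (size T))
      + K * (\<bar>real (size a) - real (size c)\<bar>
        - \<bar>real (size a) - real (size b)\<bar> - \<bar>real (size b) - real (size c)\<bar>)"
      using d_E_le_partial_matching [OF le assms(2,4) T(1), where K = K] T(2) R(3) S(3)
      by (simp add: algebra_simps)
  qed
qed

lemma d_E_triangle:
  assumes "0 < K" and le: "\<And>x y. \<lbrakk>x \<in> M; y \<in> M\<rbrakk> \<Longrightarrow> d x y \<le> 2 * K"
    and "set_mset a \<subseteq> M" "set_mset b \<subseteq> M" "set_mset c \<subseteq> M"
  shows "d_E d K a c \<le> d_E d K a b + d_E d K b c"
proof -
  obtain k where k: "k \<le> min (size a) (size c)"
    "min (size a) (size b) + min (size b) (size c) \<le> k + size b"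
    "d_E d K a c \<le> d_E d K a b + d_E d K b c
      + 2 * K * (real (min (size a) (size c)) - real k)
      + K * (\<bar>real (size a) - real (size c)\<bar>
        - \<bar>real (size a) - real (size b)\<bar> - \<bar>real (size b) - real (size c)\<bar>)"
    using d_E_triangle_bound [of "2 * K" a b c K] le assms(3-) by blast
  \<comment> \<open>If \<open>size b\<close> lies \<open>n\<close> outside the interval between
    \<open>size a\<close> and \<open>size c\<close>, at most \<open>n\<close> pairs are missing,
    while the detour through \<open>b\<close> costs \<open>2 * n * K\<close> more in size penalties:
    just enough at \<open>2 * K\<close> per pair.\<close>
  have "2 * (real (min (size a) (size c)) - real k) + (\<bar>real (size a) - real (size c)\<bar>
        - \<bar>real (size a) - real (size b)\<bar> - \<bar>real (size b) - real (size c)\<bar>) \<le> 0"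
    using k(2) by (auto simp: min_def max_def split: if_splits)
  with \<open>0 < K\<close> have "K * (2 * (real (min (size a) (size c)) - real k)
      + (\<bar>real (size a) - real (size c)\<bar>
        - \<bar>real (size a) - real (size b)\<bar> - \<bar>real (size b) - real (size c)\<bar>)) \<le> 0"
    by (intro mult_nonneg_nonpos) auto
  with k(3) show ?thesis
    by (simp add: algebra_simps)
qed

text \<open>Completing the missing pairs at \<open>K\<close> each uses only half of the extra size
  penalties of the detour; the other half is the excess.\<close>

lemma d_E_triangle_excess:
  assumes "0 < K" and le: "\<And>x y. \<lbrakk>x \<in> M; y \<in> M\<rbrakk> \<Longrightarrow> d x y \<le> K"
    and "set_mset a \<subseteq> M" "set_mset b \<subseteq> M" "set_mset c \<subseteq> M"
    and "max (size a) (size c) \<le> size b"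
  shows "d_E d K a c + K * (real (size b) - real (max (size a) (size c)))
    \<le> d_E d K a b + d_E d K b c"
proof -
  obtain k where k: "k \<le> min (size a) (size c)"
    "min (size a) (size b) + min (size b) (size c) \<le> k + size b"
    "d_E d K a c \<le> d_E d K a b + d_E d K b c
      + K * (real (min (size a) (size c)) - real k)
      + K * (\<bar>real (size a) - real (size c)\<bar>
        - \<bar>real (size a) - real (size b)\<bar> - \<bar>real (size b) - real (size c)\<bar>)"
    using d_E_triangle_bound [of K a b c K] le assms(3-5) by blast
  have "(real (min (size a) (size c)) - real k) + (\<bar>real (size a) - real (size c)\<bar>
        - \<bar>real (size a) - real (size b)\<bar> - \<bar>real (size b) - real (size c)\<bar>)
      + (real (size b) - real (max (size a) (size c))) \<le> 0"
    using k(2) assms(6) by (auto simp: min_def max_def split: if_splits)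
  with \<open>0 < K\<close> have "K * ((real (min (size a) (size c)) - real k)
      + (\<bar>real (size a) - real (size c)\<bar>
        - \<bar>real (size a) - real (size b)\<bar> - \<bar>real (size b) - real (size c)\<bar>)
      + (real (size b) - real (max (size a) (size c)))) \<le> 0"
    by (intro mult_nonneg_nonpos) auto
  with k(3) show ?thesis
    by (simp add: algebra_simps)
qed

section \<open>Triangle inequality for \<open>d_Em\<close>\<close>

lemma d_E_le_max_size:
  assumes "\<And>x y. \<lbrakk>x \<in> M; y \<in> M\<rbrakk> \<Longrightarrow> d x y \<le> K"
    and "set_mset a \<subseteq> M" "set_mset c \<subseteq> M"
  shows "d_E d K a c \<le> K * real (max (size a) (size c))"
proof -
  have "real (min (size a) (size c)) + \<bar>real (size a) - real (size c)\<bar>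
      = real (max (size a) (size c))"
    by linarith
  moreover have "d_E d K a c \<le> K * (real (min (size a) (size c)) + \<bar>real (size a) - real (size c)\<bar>)"
    \<comment> \<open>Completing the empty matching costs at most \<open>K\<close> per pair, the
      same as the penalty per unmatched element.\<close>
    using d_E_le_partial_matching [of K a c "{#}" K] assms
    by (simp add: partial_matching_def algebra_simps)
  ultimately show ?thesis by simp
qed

lemma d_Em_triangle:
  assumes "0 < K" and le: "\<And>x y. \<lbrakk>x \<in> M; y \<in> M\<rbrakk> \<Longrightarrow> d x y \<le> K"
    and a: "set_mset a \<subseteq> M" and b: "set_mset b \<subseteq> M" and c: "set_mset c \<subseteq> M"
  shows "d_Em d K a c \<le> d_Em d K a b + d_Em d K b c"
proof -
  define N where "N = max (size a) (size c)"
  have nonneg_E: "0 \<le> d_E d K u v" for u v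
    using d_E_nonneg \<open>0 < K\<close> by simp
  consider "N = 0" | "0 < N" "size b \<le> N" | "0 < N" "N < size b" by linarith
  then show ?thesis
  proof cases
    case 1
    then show ?thesis
      using nonneg_E by (simp add: d_Em_eq N_def)
  next
    case 2
    \<comment> \<open>No size exceeds \<open>N\<close>, so putting \<open>N\<close> in both
      denominators on the right only lowers the terms, and \<open>d_E_triangle\<close>
      suffices.\<close>
    have mono: "d_E d K u v / real N \<le> d_Em d K u v" if "max (size u) (size v) \<le> N" for u v
    proof (cases "max (size u) (size v) = 0")
      case True
      then show ?thesis by (simp add: d_Em_eq d_E_empty)
    next
      case False
      then have "0 < real (max (size u) (size v))" by linarith
      with that show ?thesis
        unfolding d_Em_eq by (intro divide_left_mono nonneg_E of_nat_mono mult_pos_pos) linarith+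
    qed
    have "d_E d K a c \<le> d_E d K a b + d_E d K b c"
      using le \<open>0 < K\<close> by (intro d_E_triangle a b c) force+
    then have "d_Em d K a c \<le> d_E d K a b / real N + d_E d K b c / real N"
      using \<open>0 < N\<close> by (simp add: d_Em_eq N_def divide_right_mono flip: add_divide_distrib)
    with mono [of a b] mono [of b c] 2 show ?thesis
      by (simp add: N_def)
  next
    case 3
    let ?e = "d_E d K a c" and ?f = "d_E d K a b + d_E d K b c"
    have excess: "?e + K * (real (size b) - real N) \<le> ?f"
      using d_E_triangle_excess [OF \<open>0 < K\<close> le a b c] 3 by (simp add: N_def)
    have "?e \<le> K * real N"
      using d_E_le_max_size [OF le a c] by (simp add: N_def)
    \<comment> \<open>Both denominators on the right are \<open>size b\<close>. This product
      rearranges to \<open>?e * size b \<le> (?e + K * (size b - N)) * N\<close>, to which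
      \<open>excess\<close> applies.\<close>
    then have "0 \<le> (real (size b) - real N) * (K * real N - ?e)"
      using 3 by simp
    also have "\<dots> = (?e + K * (real (size b) - real N)) * real N - ?e * real (size b)"
      by (simp add: algebra_simps)
    also have "\<dots> \<le> ?f * real N - ?e * real (size b)"
      using mult_right_mono [OF excess, of "real N"] by simp
    finally have "?e / real N \<le> ?f / real (size b)"
      using 3 by (simp add: frac_le_eq divide_simps)
    moreover have "max (size a) (size b) = size b" "max (size b) (size c) = size b"
      using 3 by (auto simp: N_def)
    ultimately show ?thesis
      by (simp add: d_Em_eq N_def add_divide_distrib)
  qed
qed

section \<open>Small multisets and the two characterisations\<close>

lemma d_E_singletons: "d_E d K {#x#} {#y#} = d x y"
  using d_E_eq_list_dist [of "[x]" _ "[y]"]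
  by (simp add: list_dist_def match_cost_def lessThan_Suc)

lemma d_E_singleton_empty: "d_E d K {#x#} {#} = K"
  using d_E_eq_list_dist [of "[]" _ "[x]" "{#x#}" d K] commute
  by (simp add: list_dist_def match_cost_def lessThan_Suc d_E_commute [of d K "{#x#}"])

text \<open>Match \<open>x\<close> with itself and leave \<open>y\<close> over. The term
  \<open>d x x\<close> remains because \<open>x\<close> may lie outside the carrier.\<close>

lemma d_E_singleton_pair_le: "d_E d K {#x#} {#x, y#} \<le> d x x + K"
  using d_E_le_full_matching [of "{#x#}" "{#x, y#}" "{#(x, x)#}" d K]
  by (simp add: partial_matching_def)

lemma Metric_space_d_E_iff:
  assumes "0 < K"
  shows "Metric_space (finite_multisets M) (d_E d K) \<longleftrightarrow> (\<forall>x\<in>M. \<forall>y\<in>M. d x y \<le> 2 * K)"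
proof
  assume metric: "Metric_space (finite_multisets M) (d_E d K)"
  show "\<forall>x\<in>M. \<forall>y\<in>M. d x y \<le> 2 * K"
  proof (intro ballI)
    fix x y assume "x \<in> M" "y \<in> M"
    then have "d_E d K {#x#} {#y#} \<le> d_E d K {#x#} {#} + d_E d K {#} {#y#}"
      by (intro Metric_space.triangle [OF metric]) (auto simp: finite_multisets_def)
    then show "d x y \<le> 2 * K"
      using commute
      by (simp add: d_E_singletons d_E_singleton_empty d_E_commute [of d K "{#}"])
  qed
next
  assume "\<forall>x\<in>M. \<forall>y\<in>M. d x y \<le> 2 * K"
  with assms show "Metric_space (finite_multisets M) (d_E d K)"
    by unfold_locales
      (auto simp: finite_multisets_def d_E_nonneg d_E_eq_0_iff commute
        intro: d_E_triangle d_E_commute)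
qed

lemma Metric_space_d_Em_iff:
  assumes "0 < K"
  shows "Metric_space (finite_multisets M) (d_Em d K) \<longleftrightarrow> (\<forall>x\<in>M. \<forall>y\<in>M. d x y \<le> K)"
proof
  assume metric: "Metric_space (finite_multisets M) (d_Em d K)"
  show "\<forall>x\<in>M. \<forall>y\<in>M. d x y \<le> K"
  proof (intro ballI)
    fix x y assume "x \<in> M" "y \<in> M"
    then have "d_Em d K {#x#} {#y#} \<le> d_Em d K {#x#} {#x, y#} + d_Em d K {#x, y#} {#y#}"
      by (intro Metric_space.triangle [OF metric]) (auto simp: finite_multisets_def)
    \<comment> \<open>Both denominators are \<open>2\<close>, so the two penalties \<open>K\<close>
      are averaged, while the left side has denominator \<open>1\<close>.\<close>
    also have "\<dots> = (d_E d K {#x#} {#x, y#} + d_E d K {#y#} {#y, x#}) / 2"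
      using commute
      by (simp add: d_Em_eq d_E_commute [of d K "{#x, y#}"] add_mset_commute add_divide_distrib)
    also have "\<dots> \<le> K"
      using d_E_singleton_pair_le [of K x y] d_E_singleton_pair_le [of K y x]
        \<open>x \<in> M\<close> \<open>y \<in> M\<close> by simp
    finally show "d x y \<le> K"
      by (simp add: d_Em_eq d_E_singletons)
  qed
next
  assume le: "\<forall>x\<in>M. \<forall>y\<in>M. d x y \<le> K"
  show "Metric_space (finite_multisets M) (d_Em d K)"
  proof
    fix a b c
    show "0 \<le> d_Em d K a b"
      using assms by (simp add: d_Em_eq d_E_nonneg)
    show "d_Em d K a b = d_Em d K b a"
      using commute by (simp add: d_Em_eq d_E_commute [of d K a b] max.commute)
    assume ab: "a \<in> finite_multisets M" "b \<in> finite_multisets M"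
    \<comment> \<open>A zero denominator means that both multisets are empty, hence equal.\<close>
    then show "d_Em d K a b = 0 \<longleftrightarrow> a = b"
      using d_E_eq_0_iff [OF assms, of a b]
      by (auto simp: d_Em_eq finite_multisets_def max_def split: if_splits)
    assume "c \<in> finite_multisets M"
    with ab le assms show "d_Em d K a c \<le> d_Em d K a b + d_Em d K b c"
      by (intro d_Em_triangle) (auto simp: finite_multisets_def)
  qed
qed

end

section \<open>From pointwise bounds to the supremum\<close>

theorem proposition1:
  fixes X :: "'a set" and d :: "'a \<Rightarrow> 'a \<Rightarrow> real" and M :: real
  assumes "Metric_space X d"
    and "\<exists>x\<in>X. \<exists>y\<in>X. x \<noteq> y"
    and "M > 0"
  shows "(\<not> bounded ((\<lambda>(x, y). d x y) ` (X \<times> X)) \<longrightarrow>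
            (\<forall>M'>0. \<not> Metric_space (finite_multisets X) (d_E d M') \<and>
                    \<not> Metric_space (finite_multisets X) (d_Em d M'))) \<and>
         (bounded ((\<lambda>(x, y). d x y) ` (X \<times> X)) \<longrightarrow>
            (let \<theta> = (SUP (x, y)\<in>X \<times> X. d x y) / M in
               (Metric_space (finite_multisets X) (d_E d M) \<longleftrightarrow> \<theta> \<le> 2) \<and>
               (Metric_space (finite_multisets X) (d_Em d M) \<longleftrightarrow> \<theta> \<le> 1)))"
proof -
  interpret Metric_space X d by fact
  let ?D = "(\<lambda>(x, y). d x y) ` (X \<times> X)"
  have bounded_if: "bounded ?D" if "\<forall>x\<in>X. \<forall>y\<in>X. d x y \<le> B" for B
    using that by (auto simp: bounded_iff)
  have sup: "(SUP (x, y)\<in>X \<times> X. d x y) / M \<le> r \<longleftrightarrow> (\<forall>x\<in>X. \<forall>y\<in>X. d x y \<le> r * M)"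
    if "bounded ?D" for r
  proof -
    \<comment> \<open>A real supremum is governed by upper bounds once the family is nonempty, by
      the two points of \<open>X\<close>, and bounded above.\<close>
    have "(SUP (x, y)\<in>X \<times> X. d x y) \<le> r * M \<longleftrightarrow> (\<forall>p\<in>X \<times> X. (case p of (x, y) \<Rightarrow> d x y) \<le> r * M)"
      using assms(2) bounded_imp_bdd_above [OF that] by (intro cSUP_le_iff) auto
    then show ?thesis
      using \<open>M > 0\<close> by (simp add: pos_divide_le_eq)
  qed
  \<comment> \<open>Either metric would bound \<open>d\<close>, by \<open>2 * M'\<close> or by
    \<open>M'\<close>.\<close>
  have "\<not> Metric_space (finite_multisets X) (d_E d M') \<and>
      \<not> Metric_space (finite_multisets X) (d_Em d M')"
    if "\<not> bounded ?D" "M' > 0" for M'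
    using bounded_if [of "2 * M'"] bounded_if [of M'] that
    by (simp only: Metric_space_d_E_iff Metric_space_d_Em_iff) blast
  moreover have "(Metric_space (finite_multisets X) (d_E d M) \<longleftrightarrow>
        (SUP (x, y)\<in>X \<times> X. d x y) / M \<le> 2) \<and>
      (Metric_space (finite_multisets X) (d_Em d M) \<longleftrightarrow>
        (SUP (x, y)\<in>X \<times> X. d x y) / M \<le> 1)"
    if "bounded ?D"
    using \<open>M > 0\<close>
    by (simp only: sup [OF that] Metric_space_d_E_iff Metric_space_d_Em_iff mult_1)
  ultimately show ?thesis
    unfolding Let_def by blast
qed

end
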